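(* Let $R$ be a commutative ring with identity whose set of zero-divisors $Z_R$ contains a nonzero element, and let $n>1$. Then $\operatorname{diam}O(M_n(R))\ge 3$, and $\operatorname{diam}O(M_n(R))>3$ if and only if there exists $a\in Z_R$ such that the ideal $\operatorname{Ann}(a)$ has no zero-divisors, i.e. $xy\ne 0$ for all nonzero $x,y\in\operatorname{Ann}(a)$.
   Context: The orthogonality graph $O(S)$ of a ring $S$ is the undirected graph whose vertices are the nonzero two-sided zero-divisors of $S$, distinct vertices $x,y$ being adjacent iff $xy=yx=0$; the diameter is the supremum of graph distances between vertices. $Z_R$ is the set of zero-divisors of $R$ (including $0$), $\operatorname{Ann}(a)=\{x\in R: ax=0\}$. *)

theory Defs
  imports "HOL-Analysis.Analysis" "HOL-Library.Extended_Nat"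
begin

(* A ring is given by its multiplication 'mul' and zero 'z' (needed because on
   matrices 'a^'n^'n the relevant product is matrix multiplication (**), not the
   componentwise '*' instance). *)

definition two_sided_zd :: "('b \<Rightarrow> 'b \<Rightarrow> 'b) \<Rightarrow> 'b \<Rightarrow> 'b \<Rightarrow> bool" where
  "two_sided_zd mul z x \<longleftrightarrow> (\<exists>y. y \<noteq> z \<and> mul x y = z) \<and> (\<exists>y. y \<noteq> z \<and> mul y x = z)"

definition orth_vertices :: "('b \<Rightarrow> 'b \<Rightarrow> 'b) \<Rightarrow> 'b \<Rightarrow> 'b set" where
  "orth_vertices mul z = {x. x \<noteq> z \<and> two_sided_zd mul z x}"

definition orth_adj :: "('b \<Rightarrow> 'b \<Rightarrow> 'b) \<Rightarrow> 'b \<Rightarrow> 'b \<Rightarrow> 'b \<Rightarrow> bool" where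
  "orth_adj mul z x y \<longleftrightarrow> x \<in> orth_vertices mul z \<and> y \<in> orth_vertices mul z \<and> x \<noteq> y
     \<and> mul x y = z \<and> mul y x = z"

definition orth_walk :: "('b \<Rightarrow> 'b \<Rightarrow> 'b) \<Rightarrow> 'b \<Rightarrow> nat \<Rightarrow> 'b \<Rightarrow> 'b \<Rightarrow> bool" where
  "orth_walk mul z k x y \<longleftrightarrow> (\<exists>f. f 0 = x \<and> f k = y \<and> (\<forall>i<k. orth_adj mul z (f i) (f (Suc i))))"

(* graph distance (\<infinity> if no path) *)
definition orth_dist :: "('b \<Rightarrow> 'b \<Rightarrow> 'b) \<Rightarrow> 'b \<Rightarrow> 'b \<Rightarrow> 'b \<Rightarrow> enat" where
  "orth_dist mul z x y = (INF k \<in> {k. orth_walk mul z k x y}. enat k)"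

definition orth_diam :: "('b \<Rightarrow> 'b \<Rightarrow> 'b) \<Rightarrow> 'b \<Rightarrow> enat" where
  "orth_diam mul z = (SUP x \<in> orth_vertices mul z. SUP y \<in> orth_vertices mul z. orth_dist mul z x y)"

(* zero-divisors of a commutative ring (including 0) and annihilators *)
definition zero_divisors :: "'a::comm_ring_1 set" where
  "zero_divisors = {a. \<exists>b. b \<noteq> 0 \<and> a * b = 0}"

definition Ann :: "'a::comm_ring_1 \<Rightarrow> 'a set" where
  "Ann a = {x. a * x = 0}"

end

theory Submission
  imports Defs "HOL-Computational_Algebra.Polynomial"
begin

text \<open>
  Lower bound: multiply the permutation matrix of the transposition $(i\,j)$ by a diagonal matrix
  with the entry $a$ in row $j$ and ones elsewhere. The two-sided annihilator of the product
  is $\mathrm{Ann}(a)\,E_{ij}$. Exchanging $i$ and $j$ gives a second vertex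
  with annihilator $\mathrm{Ann}(a)\,E_{ji}$, and a path of length three between the
  two yields nonzero $x, y \in \mathrm{Ann}(a)$ with $xy = 0$. Already $a = 0$ gives diameter at least 3.

  Upper bound: if $x \neq 0$ kills $\det A$, then some nonzero polynomial expression $X \in x R[A]$
  satisfies $AX = XA = 0$. If no $\mathrm{Ann}(a)$ with $a \in Z_R$ is free of zero-divisors, then for
  zero-divisors $a = \det A$ and $b = \det B$ there are nonzero $x \in \mathrm{Ann}(a)$ and
  $y \in \mathrm{Ann}(b)$ with $xy = 0$, and the corresponding $X, Y$ give a path $A - X - Y - B$.
\<close>

subsection \<open>Distances\<close>

lemma orth_dist_le:
  assumes "orth_walk mul z k x y"
  shows "orth_dist mul z x y \<le> enat k"
  unfolding orth_dist_def using assms by (intro INF_lower) simp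

text \<open>Peels off the first edge; with the length written in successor form, a walk of fixed
  length becomes a chain of adjacencies.\<close>

lemma orth_walk_Suc:
  "orth_walk mul z (Suc k) x y \<longleftrightarrow> (\<exists>u. orth_adj mul z x u \<and> orth_walk mul z k u y)"
proof
  assume "orth_walk mul z (Suc k) x y"
  then obtain f where f: "f 0 = x" "f (Suc k) = y" "\<forall>i<Suc k. orth_adj mul z (f i) (f (Suc i))"
    unfolding orth_walk_def by blast
  have "orth_walk mul z k (f 1) y"
    unfolding orth_walk_def using f by (intro exI[of _ "\<lambda>i. f (Suc i)"]) auto
  moreover have "orth_adj mul z x (f 1)"
    using f by auto
  ultimately show "\<exists>u. orth_adj mul z x u \<and> orth_walk mul z k u y"
    by blast
next
  assume "\<exists>u. orth_adj mul z x u \<and> orth_walk mul z k u y"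
  then obtain u f where f: "orth_adj mul z x u" "f 0 = u" "f k = y"
      "\<forall>i<k. orth_adj mul z (f i) (f (Suc i))"
    unfolding orth_walk_def by blast
  then show "orth_walk mul z (Suc k) x y"
    unfolding orth_walk_def
    by (intro exI[of _ "case_nat x f"]) (auto simp: less_Suc_eq_0_disj)
qed

lemma orth_walk_0: "orth_walk mul z 0 x y \<longleftrightarrow> x = y"
  unfolding orth_walk_def by auto

lemma orth_dist_ge_3:
  assumes "x \<noteq> y" "\<not> orth_adj mul z x y" "\<And>u. orth_adj mul z x u \<Longrightarrow> \<not> orth_adj mul z u y"
  shows "orth_dist mul z x y \<ge> 3"
  unfolding orth_dist_def
proof (rule INF_greatest)
  fix k assume "k \<in> {k. orth_walk mul z k x y}"
  then have w: "orth_walk mul z k x y" by simp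
  have "k \<noteq> 0"
    using w assms(1) by (metis orth_walk_0)
  moreover have "k \<noteq> 1"
    using w assms(2) by (auto simp: orth_walk_Suc orth_walk_0)
  moreover have "k \<noteq> 2"
    using w assms(3) by (auto simp: numeral_2_eq_2 orth_walk_Suc orth_walk_0)
  ultimately show "3 \<le> enat k"
    by (simp add: numeral_eq_enat)
qed

lemma orth_dist_gt_3:
  assumes "orth_dist mul z x y \<ge> 3"
    and "\<And>u v. orth_adj mul z x u \<Longrightarrow> orth_adj mul z u v \<Longrightarrow> \<not> orth_adj mul z v y"
  shows "orth_dist mul z x y > 3"
proof -
  \<comment> \<open>A strict bound on all lengths need not pass to an infimum, so the bound is
    stated as \<open>4 \<le>\<close> instead of \<open>3 <\<close>.\<close>
  have "4 \<le> orth_dist mul z x y"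
    unfolding orth_dist_def
  proof (rule INF_greatest)
    fix k assume "k \<in> {k. orth_walk mul z k x y}"
    then have w: "orth_walk mul z k x y" by simp
    have "k \<noteq> 3"
      using w assms(2) by (auto simp: numeral_3_eq_3 orth_walk_Suc orth_walk_0)
    moreover have "3 \<le> enat k"
      using orth_dist_le[OF w] assms(1) by (rule order_trans[rotated])
    ultimately show "4 \<le> enat k"
      by (simp add: numeral_eq_enat)
  qed
  moreover have "(3::enat) < 4"
    by simp
  ultimately show ?thesis
    by (rule less_le_trans[rotated])
qed

lemma orth_diam_ge:
  assumes "x \<in> orth_vertices mul z" "y \<in> orth_vertices mul z"
  shows "orth_dist mul z x y \<le> orth_diam mul z"
  unfolding orth_diam_def using assms
  by (intro SUP_upper2[of x] SUP_upper2[of y]) auto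

text \<open>Nonzero elements that annihilate a vertex on both sides are themselves vertices.
  Coincidences among \<open>x\<close>, \<open>u\<close>, \<open>v\<close>, \<open>y\<close> destroy
  an adjacency, but they only shorten the walk.\<close>

lemma orth_dist_le_3:
  assumes "x \<in> orth_vertices mul z" "y \<in> orth_vertices mul z"
    and "u \<noteq> z" "v \<noteq> z" and "mul x u = z" "mul u x = z" and "mul u v = z" "mul v u = z"
    and "mul v y = z" "mul y v = z"
  shows "orth_dist mul z x y \<le> 3"
proof -
  have nz: "x \<noteq> z" "y \<noteq> z"
    using assms(1,2) by (simp_all add: orth_vertices_def)
  have u: "u \<in> orth_vertices mul z"
    unfolding orth_vertices_def two_sided_zd_def using assms(3,5,6) nz by blast
  have v: "v \<in> orth_vertices mul z"
    unfolding orth_vertices_def two_sided_zd_def using assms(4,9,10) nz by blast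
  have adj: "x = u \<or> orth_adj mul z x u" "u = v \<or> orth_adj mul z u v"
      "v = y \<or> orth_adj mul z v y"
    unfolding orth_adj_def using assms(1,2,5-) u v by simp_all
  have ext: "\<exists>k\<le>Suc n. orth_walk mul z k p r"
    if pq: "p = q \<or> orth_adj mul z p q" and qr: "\<exists>k\<le>n. orth_walk mul z k q r" for p q r n
  proof -
    obtain k where k: "k \<le> n" "orth_walk mul z k q r"
      using qr by blast
    from pq show ?thesis
    proof
      assume "p = q"
      then show ?thesis using k by (intro exI[of _ k]) simp
    next
      assume "orth_adj mul z p q"
      then have "orth_walk mul z (Suc k) p r"
        using k(2) by (auto simp: orth_walk_Suc)
      then show ?thesis using k(1) by (intro exI[of _ "Suc k"]) simp
    qed
  qed
  have "\<exists>k\<le>0. orth_walk mul z k y y"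
    by (simp add: orth_walk_0)
  from ext[OF adj(1) ext[OF adj(2) ext[OF adj(3) this]]]
  obtain k where "k \<le> 3" "orth_walk mul z k x y"
    unfolding numeral_3_eq_3 by blast
  then have "orth_dist mul z x y \<le> enat k" "enat k \<le> 3"
    using orth_dist_le by (auto simp: numeral_eq_enat)
  then show ?thesis
    by (rule order_trans)
qed

subsection \<open>Vertices at large distance\<close>

text \<open>For \<open>i \<noteq> j\<close> the entry \<open>a\<close> sits at
  \<open>(j, i)\<close>, so left multiplication scales row \<open>j\<close> and right multiplication
  scales column \<open>i\<close>.\<close>

definition swap_mat :: "'n \<Rightarrow> 'n \<Rightarrow> 'a \<Rightarrow> 'a::comm_ring_1^'n^'n" where
  "swap_mat i j a = (\<chi> r s. if s = Transposition.transpose i j r then (if r = j then a else 1) else 0)"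

definition unit_mat :: "'n \<Rightarrow> 'n \<Rightarrow> 'a \<Rightarrow> 'a::comm_ring_1^'n^'n" where
  "unit_mat i j x = (\<chi> r s. if r = i \<and> s = j then x else 0)"

lemma transpose_eq_first_iff: "Transposition.transpose i j r = i \<longleftrightarrow> r = j"
  by (auto simp: transpose_eq_iff)

lemma transpose_eq_second_iff: "Transposition.transpose i j r = j \<longleftrightarrow> r = i"
  by (auto simp: transpose_eq_iff)

lemma swap_mat_mult_component:
  "(swap_mat i j a ** X) $ r $ s = (if r = j then a else 1) * X $ Transposition.transpose i j r $ s"
proof -
  have "(swap_mat i j a ** X) $ r $ s
      = (\<Sum>k\<in>UNIV. if k = Transposition.transpose i j r then (if r = j then a else 1) * X $ k $ s else 0)"
    unfolding swap_mat_def matrix_matrix_mult_def vec_lambda_beta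
    by (intro sum.cong refl) simp
  then show ?thesis
    by simp
qed

lemma mult_swap_mat_component:
  "(X ** swap_mat i j a) $ r $ s = X $ r $ Transposition.transpose i j s * (if s = i then a else 1)"
proof -
  have "(X ** swap_mat i j a) $ r $ s
      = (\<Sum>k\<in>UNIV. if k = Transposition.transpose i j s then X $ r $ k * (if k = j then a else 1) else 0)"
    unfolding swap_mat_def matrix_matrix_mult_def vec_lambda_beta
  proof (intro sum.cong refl)
    fix k
    \<comment> \<open>A transposition is its own inverse, so the condition can be solved for the
      summation index \<open>k\<close>.\<close>
    have "s = Transposition.transpose i j k \<longleftrightarrow> k = Transposition.transpose i j s"
      by auto
    then show "X $ r $ k * (if s = Transposition.transpose i j k then if k = j then a else 1 else 0)
        = (if k = Transposition.transpose i j s then X $ r $ k * (if k = j then a else 1) else 0)"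
      by simp
  qed
  also have "\<dots> = X $ r $ Transposition.transpose i j s * (if Transposition.transpose i j s = j then a else 1)"
    by simp
  also have "Transposition.transpose i j s = j \<longleftrightarrow> s = i"
    by (rule transpose_eq_second_iff)
  finally show ?thesis .
qed

text \<open>The left product contains every row of \<open>X\<close> unscaled except row
  \<open>i\<close>, which is multiplied by \<open>a\<close>; the right product does the same with
  columns and column \<open>j\<close>. Only the entry at \<open>(i, j)\<close> escapes both, and
  \<open>a\<close> must kill it.\<close>

lemma swap_mat_annihilator:
  fixes X :: "'a::comm_ring_1^'n::finite^'n"
  assumes ij: "i \<noteq> j"
  shows "swap_mat i j a ** X = 0 \<and> X ** swap_mat i j a = 0 \<longleftrightarrow> (\<exists>x\<in>Ann a. X = unit_mat i j x)"
    (is "?lhs \<longleftrightarrow> ?rhs")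
proof
  assume lhs: ?lhs
  have L: "(if r = j then a else 1) * X $ Transposition.transpose i j r $ s = 0" for r s
    using lhs swap_mat_mult_component[of i j a X r s] by simp
  have R: "X $ r $ Transposition.transpose i j s * (if s = i then a else 1) = 0" for r s
    using lhs mult_swap_mat_component[of X i j a r s] by simp
  have "X $ r $ s = 0" if "r \<noteq> i" for r s
    using L[of "Transposition.transpose i j r" s] that by (simp add: transpose_eq_second_iff)
  moreover have "X $ r $ s = 0" if "s \<noteq> j" for r s
    using R[of r "Transposition.transpose i j s"] that by (simp add: transpose_eq_first_iff)
  ultimately have "X = unit_mat i j (X $ i $ j)"
    by (auto simp: vec_eq_iff unit_mat_def)
  moreover have "X $ i $ j \<in> Ann a"
    using L[of j j] by (simp add: Ann_def)
  ultimately show ?rhs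
    by blast
next
  assume ?rhs
  then obtain x where x: "a * x = 0" "X = unit_mat i j x"
    by (auto simp: Ann_def)
  show ?lhs
    using ij x
    by (simp add: transpose_eq_first_iff transpose_eq_second_iff vec_eq_iff swap_mat_mult_component mult_swap_mat_component unit_mat_def mult.commute[of x a])
qed

lemma unit_mat_mult_unit_mat: "unit_mat i j x ** unit_mat j i y = unit_mat i i (x * y)"
proof -
  have "(\<Sum>k\<in>UNIV. (if r = i \<and> k = j then x else 0) * (if k = j \<and> s = i then y else 0))
     = (\<Sum>k\<in>UNIV. if k = j then (if r = i \<and> s = i then x * y else 0) else 0)" for r s
    by (intro sum.cong) auto
  then show ?thesis
    by (simp add: vec_eq_iff unit_mat_def matrix_matrix_mult_def)
qed

lemma unit_mat_eq_0_iff: "unit_mat i j x = 0 \<longleftrightarrow> x = 0"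
  by (auto simp: vec_eq_iff unit_mat_def)

lemma swap_mat_component: "swap_mat i j a $ i $ j = (if i = j then a else 1)"
  by (simp add: swap_mat_def)

lemma swap_mat_vertex:
  fixes i j :: "'n::finite"
  assumes "i \<noteq> j" "a \<in> zero_divisors"
  shows "(swap_mat i j a :: 'a::comm_ring_1^'n^'n) \<in> orth_vertices (**) 0"
proof -
  obtain b where b: "b \<noteq> 0" "b \<in> Ann a"
    using assms(2) by (auto simp: zero_divisors_def Ann_def)
  then have "swap_mat i j a ** unit_mat i j b = 0 \<and> unit_mat i j b ** swap_mat i j a = 0"
    using swap_mat_annihilator[OF assms(1)] by blast
  \<comment> \<open>The entry at \<open>(i, j)\<close> is 1 whatever \<open>a\<close> is, so
    \<open>a = 0\<close> is covered.\<close>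
  moreover have "(swap_mat i j a :: 'a^'n^'n) \<noteq> 0"
    using assms(1) b swap_mat_component[of i j a] by (auto simp: Ann_def)
  moreover have "(unit_mat i j b :: 'a^'n^'n) \<noteq> 0"
    using b by (simp add: unit_mat_eq_0_iff)
  ultimately show ?thesis
    unfolding orth_vertices_def two_sided_zd_def by blast
qed

lemma swap_mat_adj:
  fixes i j :: "'n::finite" and X :: "'a::comm_ring_1^'n^'n"
  assumes "i \<noteq> j" "orth_adj (**) 0 (swap_mat i j a) X \<or> orth_adj (**) 0 X (swap_mat i j a)"
  shows "\<exists>x\<in>Ann a. x \<noteq> 0 \<and> X = unit_mat i j x"
proof -
  have "swap_mat i j a ** X = 0 \<and> X ** swap_mat i j a = 0" "X \<noteq> 0"
    using assms(2) by (auto simp: orth_adj_def orth_vertices_def)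
  then show ?thesis
    using swap_mat_annihilator[OF assms(1), of a X] unit_mat_eq_0_iff by blast
qed

text \<open>Neighbours of the two vertices are supported at \<open>(i, j)\<close> and at
  \<open>(j, i)\<close> respectively, so none is shared. The vertices are not adjacent, as their
  product has entry 1 at \<open>(i, i)\<close>.\<close>

lemma swap_mat_dist_ge_3:
  fixes i j :: "'n::finite" and a :: "'a::comm_ring_1"
  assumes ij: "i \<noteq> j" and a: "a \<in> zero_divisors"
  shows "orth_dist (**) 0 (swap_mat i j a :: 'a^'n^'n) (swap_mat j i a) \<ge> 3"
proof (rule orth_dist_ge_3)
  have "a \<noteq> 1"
    using a by (auto simp: zero_divisors_def)
  moreover have "(swap_mat j i a :: 'a^'n^'n) $ i $ j = a"
    by (simp add: swap_mat_def)
  moreover have "(swap_mat i j a :: 'a^'n^'n) $ i $ j = 1"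
    using ij by (simp add: swap_mat_def)
  ultimately show "(swap_mat i j a :: 'a^'n^'n) \<noteq> swap_mat j i a"
    by auto
  have "((swap_mat i j a :: 'a^'n^'n) ** swap_mat j i a) $ i $ i = 1"
    using ij by (simp add: swap_mat_mult_component swap_mat_component)
  moreover have "(1::'a) \<noteq> 0"
    using a by (auto simp: zero_divisors_def)
  ultimately show "\<not> orth_adj (**) 0 (swap_mat i j a :: 'a^'n^'n) (swap_mat j i a)"
    unfolding orth_adj_def by auto
next
  fix U :: "'a^'n^'n"
  assume U: "orth_adj (**) 0 (swap_mat i j a) U"
  show "\<not> orth_adj (**) 0 U (swap_mat j i a)"
  proof
    assume "orth_adj (**) 0 U (swap_mat j i a)"
    then obtain y where "U = unit_mat j i y"
      using swap_mat_adj[OF ij[symmetric], of a U] by blast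
    moreover obtain x where "x \<noteq> 0" "U = unit_mat i j x"
      using U swap_mat_adj[OF ij, of a U] by blast
    ultimately have "(unit_mat i j x :: 'a^'n^'n) $ i $ j = (unit_mat j i y :: 'a^'n^'n) $ i $ j"
      by simp
    then have "x = 0"
      using ij by (simp add: unit_mat_def)
    with \<open>x \<noteq> 0\<close> show False by simp
  qed
qed

text \<open>The inner vertices of a walk of length three would have a product with
  \<open>x * y\<close> at \<open>(i, i)\<close>, for nonzero \<open>x\<close> and \<open>y\<close>
  in \<open>Ann a\<close>.\<close>

lemma swap_mat_dist_gt_3:
  fixes i j :: "'n::finite" and a :: "'a::comm_ring_1"
  assumes ij: "i \<noteq> j" and a: "a \<in> zero_divisors"
    and dom: "\<forall>x\<in>Ann a. \<forall>y\<in>Ann a. x \<noteq> 0 \<and> y \<noteq> 0 \<longrightarrow> x * y \<noteq> 0"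
  shows "orth_dist (**) 0 (swap_mat i j a :: 'a^'n^'n) (swap_mat j i a) > 3"
proof (rule orth_dist_gt_3[OF swap_mat_dist_ge_3[OF ij a]])
  fix U V :: "'a^'n^'n"
  assume U: "orth_adj (**) 0 (swap_mat i j a) U" and UV: "orth_adj (**) 0 U V"
  show "\<not> orth_adj (**) 0 V (swap_mat j i a)"
  proof
    assume V: "orth_adj (**) 0 V (swap_mat j i a)"
    obtain x where x: "x \<in> Ann a" "x \<noteq> 0" "U = unit_mat i j x"
      using U swap_mat_adj[OF ij, of a U] by blast
    obtain y where y: "y \<in> Ann a" "y \<noteq> 0" "V = unit_mat j i y"
      using V swap_mat_adj[OF ij[symmetric], of a V] by blast
    have "unit_mat i i (x * y) = 0"
      using UV x y by (simp add: orth_adj_def unit_mat_mult_unit_mat)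
    then show False
      using dom x y by (simp add: unit_mat_eq_0_iff)
  qed
qed

subsection \<open>Determinants over commutative rings\<close>

text \<open>The cofactor of \<open>A\<close> at \<open>(k, i)\<close>, written with a unit vector in
  row \<open>k\<close> so that the index type stays \<open>'n\<close>.\<close>

definition adjugate :: "'a::comm_ring_1^'n^'n \<Rightarrow> 'a^'n^'n" where
  "adjugate A = (\<chi> i k. det (\<chi> r. if r = k then axis i 1 else A $ r))"

text \<open>Linearity in row \<open>k\<close> reassembles row \<open>j\<close> of \<open>A\<close>
  in that place; for \<open>j \<noteq> k\<close> the resulting matrix has two equal rows.\<close>

lemma mult_adjugate:
  fixes A :: "'a::comm_ring_1^'n::finite^'n"
  shows "A ** adjugate A = mat (det A)"
proof -
  have "(A ** adjugate A) $ j $ k = (if j = k then det A else 0)" for j k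
  proof -
    have "(A ** adjugate A) $ j $ k
        = (\<Sum>i\<in>UNIV. det (\<chi> r. if r = k then A $ j $ i *s axis i 1 else A $ r))"
      by (simp add: matrix_matrix_mult_def adjugate_def det_row_mul)
    also have "\<dots> = det (\<chi> r. if r = k then (\<Sum>i\<in>UNIV. A $ j $ i *s axis i 1) else A $ r)"
      by (simp add: det_linear_row_sum)
    also have "(\<Sum>i\<in>UNIV. A $ j $ i *s axis i 1) = A $ j"
      by (rule basis_expansion)
    also have "det (\<chi> r. if r = k then A $ j else A $ r) = (if j = k then det A else 0)"
    proof (cases "j = k")
      case True
      then have "(\<chi> r. if r = k then A $ j else A $ r) = A"
        by (simp add: vec_eq_iff)
      with True show ?thesis by simp
    next
      case False
      then show ?thesis
        by (simp add: det_identical_rows[of j k] row_def vec_eq_iff)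
    qed
    finally show ?thesis .
  qed
  then show ?thesis
    by (simp add: vec_eq_iff mat_def)
qed

section \<open>Scalar matrices\<close>

lemma mat_mult_component: "(mat c ** M) $ i $ j = c * M $ i $ j"
  by (simp add: matrix_matrix_mult_def mat_def if_distrib if_distribR cong: if_cong)

lemma mult_mat_component: "(M ** mat c) $ i $ j = M $ i $ j * c"
  by (simp add: matrix_matrix_mult_def mat_def if_distrib if_distribR cong: if_cong)

lemma mat_commute: "mat (c::'a::comm_ring_1) ** M = M ** mat c"
  by (simp add: vec_eq_iff mat_mult_component mult_mat_component mult.commute)

lemma mat_mult_left_commute:
  "M ** (mat (c::'a::comm_ring_1) ** N) = mat c ** (M ** N)"
  by (metis mat_commute matrix_mul_assoc)

lemma mat_mult_mat: "mat c ** mat d = mat (c * d)"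
  by (simp add: vec_eq_iff mat_mult_component) (simp add: mat_def)

lemma mat_mult_mat_assoc: "mat c ** (mat d ** M) = mat (c * d) ** M"
  by (simp add: matrix_mul_assoc mat_mult_mat)

lemma matrix_add_rdistrib: "(A + B) ** C = A ** C + B ** C"
  by (simp add: vec_eq_iff matrix_matrix_mult_def distrib_right sum.distrib)

lemma mat_add: "mat (c + d) = mat c + (mat d :: 'a::comm_ring_1^'n^'n)"
  by (simp add: vec_eq_iff mat_def)

lemma det_mat: "det (mat (c::'a::comm_ring_1) :: 'a^'n^'n) = c ^ CARD('n)"
  by (subst det_diagonal) (auto simp: mat_def)

text \<open>Multiplying \<open>X ** A = 0\<close> by the adjugate shows that \<open>det A\<close>
  kills every entry of \<open>X\<close>.\<close>

lemma det_zero_divisor: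
  fixes A :: "'a::comm_ring_1^'n::finite^'n"
  assumes "X \<noteq> 0" "X ** A = 0"
  shows "det A \<in> zero_divisors"
proof -
  have "X ** mat (det A) = 0"
    using assms(2) by (metis mult_adjugate matrix_mul_assoc times0_left)
  moreover obtain i j where "X $ i $ j \<noteq> 0"
    using assms(1) by (auto simp: vec_eq_iff)
  ultimately show ?thesis
    by (auto simp: zero_divisors_def vec_eq_iff mult_mat_component mult.commute)
qed

text \<open>The relation \<open>x * u = x * v\<close> is congruence modulo the ideal
  \<open>Ann x\<close>, hence compatible with products.\<close>

lemma mult_prod_cong:
  fixes x :: "'a::comm_ring_1"
  assumes "finite S" "\<And>i. i \<in> S \<Longrightarrow> x * f i = x * g i"
  shows "x * prod f S = x * prod g S"
  using assms
proof (induction S rule: finite_induct)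
  case (insert a S)
  have "x * prod f (insert a S) = f a * (x * prod f S)"
    using insert.hyps by (simp add: mult_ac)
  also have "\<dots> = (x * f a) * prod g S"
  proof -
    have "x * prod f S = x * prod g S"
      using insert.prems by (intro insert.IH) auto
    then show ?thesis
      by (simp add: mult_ac)
  qed
  also have "\<dots> = (x * g a) * prod g S"
    by (simp only: insert.prems[OF insertI1])
  also have "\<dots> = x * prod g (insert a S)"
    using insert.hyps by (simp add: mult.assoc)
  finally show ?case .
qed simp

text \<open>A determinant is a polynomial in the entries and so respects congruence modulo
  \<open>Ann x\<close>. This replaces passing to the quotient ring.\<close>

lemma mult_det_cong:
  fixes M N :: "'a::comm_ring_1^'n::finite^'n"
  assumes "mat x ** M = mat x ** N"
  shows "x * det M = x * det N"
proof -
  have "x * (of_int (sign p) * (\<Prod>i\<in>UNIV. M $ i $ p i))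
      = x * (of_int (sign p) * (\<Prod>i\<in>UNIV. N $ i $ p i))" for p
  proof -
    have "x * M $ i $ p i = x * N $ i $ p i" for i
      using assms by (metis mat_mult_component)
    then have "x * (\<Prod>i\<in>UNIV. M $ i $ p i) = x * (\<Prod>i\<in>UNIV. N $ i $ p i)"
      by (intro mult_prod_cong) auto
    then show ?thesis
      by (simp only: mult.left_commute[of x "of_int (sign p)"])
  qed
  then show ?thesis
    by (simp add: det_def sum_distrib_left)
qed

subsection \<open>Polynomials in a matrix\<close>

text \<open>Horner evaluation of the polynomial at \<open>A\<close>, with \<open>**\<close> in place
  of the componentwise product.\<close>

definition mpoly :: "'a::comm_ring_1^'n^'n \<Rightarrow> 'a poly \<Rightarrow> 'a^'n^'n" where
  "mpoly A p = fold_coeffs (\<lambda>c M. mat c + A ** M) p 0"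

lemma mpoly_0 [simp]: "mpoly A 0 = 0"
  by (simp add: mpoly_def)

lemma mpoly_pCons [simp]: "mpoly A (pCons c p) = mat c + A ** mpoly A p"
  by (cases "c = 0 \<and> p = 0") (auto simp: mpoly_def)

lemma mpoly_add: "mpoly A (p + q) = mpoly A p + mpoly A q"
  by (induction p q rule: poly_induct2) (simp_all add: matrix_add_ldistrib mat_add)

lemma mpoly_sum: "mpoly A (sum f S) = (\<Sum>i\<in>S. mpoly A (f i))"
  by (induction S rule: infinite_finite_induct) (simp_all add: mpoly_add)

lemma mpoly_smult: "mpoly A (smult c p) = mat c ** mpoly A p"
  by (induction p)
    (simp_all add: matrix_add_ldistrib mat_mult_mat mat_mult_left_commute)

lemma mpoly_mult: "mpoly A (p * q) = mpoly A p ** mpoly A q"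
  by (induction p)
    (simp_all add: mpoly_add mpoly_smult matrix_add_rdistrib matrix_mul_assoc)

lemma mpoly_commute: "mpoly A p ** A = A ** mpoly A p"
  by (induction p)
    (simp_all add: matrix_add_rdistrib matrix_add_ldistrib mat_commute matrix_mul_assoc[symmetric])

text \<open>The coefficient is taken at \<open>card S\<close> because the degree may be smaller. The
  degree bound is carried along so that constant terms of new factors do not contribute to
  it.\<close>

lemma coeff_prod_linear:
  fixes f :: "'b \<Rightarrow> 'a::comm_ring_1 poly"
  assumes "finite S" "\<And>i. i \<in> S \<Longrightarrow> degree (f i) \<le> 1"
  shows "coeff (prod f S) (card S) = (\<Prod>i\<in>S. coeff (f i) 1) \<and> degree (prod f S) \<le> card S"
  using assms
proof (induction S rule: finite_induct)
  case (insert a S)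
  then have IH: "coeff (prod f S) (card S) = (\<Prod>i\<in>S. coeff (f i) 1)" "degree (prod f S) \<le> card S"
    and a: "degree (f a) \<le> 1" by auto
  have "f a = [:coeff (f a) 0, coeff (f a) 1:]"
    using a by (auto simp: poly_eq_iff coeff_pCons coeff_eq_0 split: nat.split)
  moreover have "coeff ([:c, d:] * prod f S) (1 + card S) = d * coeff (prod f S) (card S)" for c d
    using IH(2) by (simp add: coeff_eq_0)
  ultimately have "coeff (f a * prod f S) (1 + card S) = coeff (f a) 1 * coeff (prod f S) (card S)"
    by metis
  moreover have "degree (f a * prod f S) \<le> 1 + card S"
    using degree_mult_le[of "f a" "prod f S"] a IH(2) by linarith
  ultimately show ?case
    using insert.hyps IH by simp
qed simp

text \<open>The transpose of \<open>t I - A\<close>. Its columns encode the relations between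
  \<open>A\<close> and the rows of the identity, and right multiplication by the adjugate combines
  columns.\<close>

definition char_mat :: "'a::comm_ring_1^'n^'n \<Rightarrow> 'a poly^'n^'n" where
  "char_mat A = (\<chi> j i. [:- (A $ i $ j), if i = j then 1 else 0:])"

text \<open>At \<open>CARD('n)\<close> the Leibniz formula leaves the determinant of the matrix of
  linear coefficients, which is the identity. The degree bound makes this the leading
  coefficient.\<close>

lemma monic_det_char_mat:
  fixes A :: "'a::comm_ring_1^'n::finite^'n"
  shows "lead_coeff (det (char_mat A)) = 1"
proof -
  let ?term = "\<lambda>p. of_int (sign p) * (\<Prod>i\<in>UNIV. char_mat A $ i $ p i)"
  have coeff_of_int: "coeff (of_int k * q) m = of_int k * coeff q m" for k m and q :: "'a poly"
    by (simp add: of_int_poly)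
  have deg: "degree (char_mat A $ i $ j) \<le> 1" for i j
    by (auto simp: char_mat_def)
  have lin: "coeff (\<Prod>i\<in>UNIV. char_mat A $ i $ p i) CARD('n)
        = (\<Prod>i\<in>UNIV. coeff (char_mat A $ i $ p i) 1)"
      "degree (\<Prod>i\<in>UNIV. char_mat A $ i $ p i) \<le> CARD('n)" for p
    using coeff_prod_linear[of UNIV "\<lambda>i. char_mat A $ i $ p i"] deg by auto
  have "coeff (det (char_mat A)) CARD('n) = det (mat 1 :: 'a^'n^'n)"
    unfolding det_def
    by (simp add: coeff_sum coeff_of_int lin(1)) (simp add: char_mat_def mat_def eq_commute)
  then have top: "coeff (det (char_mat A)) CARD('n) = 1"
    by simp
  have "degree (?term p) \<le> CARD('n)" for p
    using order_trans[OF degree_smult_le lin(2)[of p]] by (simp add: of_int_poly)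
  then have le: "degree (det (char_mat A)) \<le> CARD('n)"
    unfolding det_def by (intro degree_sum_le) auto
  show ?thesis
  proof (cases "(1::'a) = 0")
    case True
    have "u = v" for u v :: 'a
      using True by (metis mult_1_right mult_zero_right)
    then show ?thesis .
  next
    case False
    with top have "degree (det (char_mat A)) \<ge> CARD('n)"
      by (intro le_degree) simp
    with le top show ?thesis by simp
  qed
qed

text \<open>
  Let the polynomial ring act on row vectors through \<open>A\<close>. The rows of the identity are
  killed by \<open>char_mat A\<close>, hence by its determinant.
\<close>

lemma cayley_hamilton:
  fixes A :: "'a::comm_ring_1^'n::finite^'n"
  shows "mpoly A (det (char_mat A)) = 0"
proof -
  let ?C = "char_mat A" and ?D = "adjugate (char_mat A)"
  \<comment> \<open>With \<open>e_j\<close> the rows of the identity, this says that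
    \<open>e_i A\<close> equals the sum of all \<open>A_ij e_j\<close>.\<close>
  have rows: "(\<Sum>j\<in>UNIV. mpoly A (?C $ j $ i) $ j $ m) = 0" for i m
  proof -
    have "mpoly A (?C $ j $ i) $ j $ m
        = (if j = m then - (A $ i $ j) else 0) + (if j = i then A $ j $ m else 0)" for j
      by (auto simp: char_mat_def) (auto simp: mat_def)
    then show ?thesis
      by (simp add: sum.distrib)
  qed
  have "mpoly A (det ?C) $ k $ l = 0" for k l
  proof -
    have "(\<Sum>j\<in>UNIV. mpoly A ((?C ** ?D) $ j $ k) $ j $ l)
        = (\<Sum>j\<in>UNIV. if j = k then mpoly A (det ?C) $ j $ l else 0)"
      by (intro sum.cong) (auto simp: mult_adjugate mat_def)
    then have "mpoly A (det ?C) $ k $ l = (\<Sum>j\<in>UNIV. mpoly A ((?C ** ?D) $ j $ k) $ j $ l)"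
      by simp
    also have "\<dots> = (\<Sum>j\<in>UNIV. \<Sum>i\<in>UNIV. \<Sum>m\<in>UNIV.
        mpoly A (?C $ j $ i) $ j $ m * mpoly A (?D $ i $ k) $ m $ l)"
      by (simp add: matrix_matrix_mult_def[of ?C] mpoly_sum mpoly_mult)
         (simp add: matrix_matrix_mult_def)
    \<comment> \<open>Moving \<open>j\<close> innermost exposes the vanishing sums of
      \<open>rows\<close>.\<close>
    also have "\<dots> = (\<Sum>i\<in>UNIV. \<Sum>m\<in>UNIV. \<Sum>j\<in>UNIV.
        mpoly A (?C $ j $ i) $ j $ m * mpoly A (?D $ i $ k) $ m $ l)"
      by (rule trans[OF sum.swap]) (intro sum.cong refl sum.swap)
    also have "\<dots> = 0"
      by (simp add: sum_distrib_right[symmetric] rows)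
    finally show ?thesis .
  qed
  then show ?thesis
    by (simp add: vec_eq_iff)
qed

text \<open>
  Write $p = c + t q$. Modulo $\mathrm{Ann}(x)$ the scalar $c$ is a multiple of $A$ with
  $\det A = 0$, so $c$ is nilpotent. Replacing $x$ by the last nonzero $x c^k$
  gives $x\,A\,q(A) = 0$.
\<close>

lemma commuting_annihilator_of_monic:
  fixes A :: "'a::comm_ring_1^'n::finite^'n"
  assumes "lead_coeff p = 1" "x \<noteq> 0" "x * det A = 0" "mat x ** mpoly A p = 0"
  shows "\<exists>M. mat x ** M \<noteq> 0 \<and> A ** (mat x ** M) = 0 \<and> (mat x ** M) ** A = 0"
  using assms
proof (induction p arbitrary: x rule: pCons_induct)
  case 0
  then have "(0::'a) = 1"
    by simp
  then have "x = 0"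
    by (metis mult_1_right mult_zero_right)
  with 0 show ?case by simp
next
  case (pCons c p)
  show ?case
  proof (cases "p = 0")
    case True
    with pCons.prems have "mat x = (0 :: 'a^'n^'n)"
      by simp
    then have "(mat x :: 'a^'n^'n) $ undefined $ undefined = 0"
      by simp
    then have "x = 0"
      by (simp add: mat_def)
    with pCons.prems show ?thesis by simp
  next
    case False
    then have monic: "lead_coeff p = 1"
      using pCons.prems by simp
    have "mat x ** mat c + mat x ** (A ** mpoly A p) = 0"
      using pCons.prems(4) by (simp add: matrix_add_ldistrib)
    then have eq: "mat x ** mat c = mat x ** (A ** - mpoly A p)"
      by (simp add: vec_eq_iff matrix_matrix_mult_def sum_negf eq_neg_iff_add_eq_0)
    have "x * det (mat c :: 'a^'n^'n) = x * det (A ** - mpoly A p)"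
      using eq by (rule mult_det_cong)
    also have "\<dots> = 0"
      using pCons.prems(3) by (simp add: det_mul mult.assoc[symmetric])
    finally have nil: "x * c ^ CARD('n) = 0"
      by (simp add: det_mat)
    define k where "k = (LEAST k. x * c ^ k = 0)"
    have k0: "x * c ^ k = 0"
      unfolding k_def using nil by (rule LeastI)
    then obtain l where l: "k = Suc l"
      using pCons.prems(2) by (cases k) auto
    define y where "y = x * c ^ l"
    have y: "y \<noteq> 0"
      using not_less_Least[of l "\<lambda>k. x * c ^ k = 0"] l by (auto simp: y_def k_def)
    have yc: "y * c = 0"
      using k0 l by (simp add: y_def mult_ac)
    \<comment> \<open>Multiples of \<open>y\<close> are multiples of \<open>x\<close>, so a witness
      found for \<open>y\<close> also serves for \<open>x\<close>.\<close>
    have mat_y: "mat y ** M = mat x ** (mat (c ^ l) ** M)" for M :: "'a^'n^'n"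
      by (simp add: mat_mult_mat_assoc y_def)
    have "mat y ** mpoly A (pCons c p) = 0"
    proof -
      have "mat y ** mpoly A (pCons c p) = mat (c ^ l) ** (mat x ** mpoly A (pCons c p))"
        unfolding mat_y by (rule mat_mult_left_commute)
      then show ?thesis
        using pCons.prems(4) by simp
    qed
    then have yA: "A ** (mat y ** mpoly A p) = 0"
      by (simp add: matrix_add_ldistrib mat_mult_mat yc mat_mult_left_commute)
    \<comment> \<open>If \<open>mat y ** mpoly A p\<close> is nonzero, it is the witness, as it
      commutes with \<open>A\<close>. Otherwise \<open>y\<close> and the monic \<open>p\<close> of
      lower degree satisfy the induction hypothesis.\<close>
    show ?thesis
    proof (cases "mat y ** mpoly A p = 0")
      case True
      have "y * det A = 0"
        using pCons.prems(3) unfolding y_def by (metis mult.assoc mult.commute mult_zero_left)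
      then obtain M where "mat y ** M \<noteq> 0 \<and> A ** (mat y ** M) = 0 \<and> (mat y ** M) ** A = 0"
        using pCons.IH[OF monic y _ True] by blast
      then show ?thesis
        unfolding mat_y by blast
    next
      case False
      moreover have "(mat y ** mpoly A p) ** A = 0"
        using yA by (metis matrix_mul_assoc mpoly_commute mat_commute)
      ultimately show ?thesis
        using yA unfolding mat_y by blast
    qed
  qed
qed

text \<open>A converse to \<open>det_zero_divisor\<close>, with Cayley-Hamilton supplying the monic
  polynomial. The factor \<open>mat x\<close> stays visible so that orthogonal scalars yield
  orthogonal matrices.\<close>

lemma two_sided_annihilator:
  fixes A :: "'a::comm_ring_1^'n::finite^'n"
  assumes "x \<noteq> 0" "x \<in> Ann (det A)"
  obtains M where "mat x ** M \<noteq> 0" "A ** (mat x ** M) = 0" "(mat x ** M) ** A = 0"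
proof -
  have "x * det A = 0" "mat x ** mpoly A (det (char_mat A)) = 0"
    using assms(2) by (simp_all add: cayley_hamilton Ann_def mult.commute)
  then show ?thesis
    using commuting_annihilator_of_monic[OF monic_det_char_mat assms(1)] that by blast
qed

subsection \<open>Short paths between vertices\<close>

text \<open>Let \<open>x1 * x2 = 0\<close> in \<open>Ann a\<close> and let \<open>y\<close> be
  nonzero in \<open>Ann b\<close>. Either \<open>x1 * y = 0\<close>, or \<open>x1 * y\<close> is a
  nonzero element of \<open>Ann b\<close> killed by \<open>x2\<close>.\<close>

lemma orthogonal_annihilators:
  fixes a b :: "'a::comm_ring_1"
  assumes "\<exists>x\<in>Ann a. \<exists>y\<in>Ann a. x \<noteq> 0 \<and> y \<noteq> 0 \<and> x * y = 0"
    and "b \<in> zero_divisors"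
  obtains x y where "x \<in> Ann a" "y \<in> Ann b" "x \<noteq> 0" "y \<noteq> 0" "x * y = 0"
proof -
  obtain x1 x2 where x: "x1 \<in> Ann a" "x2 \<in> Ann a" "x1 \<noteq> 0" "x2 \<noteq> 0" "x1 * x2 = 0"
    using assms(1) by blast
  obtain y where y: "y \<in> Ann b" "y \<noteq> 0"
    using assms(2) by (auto simp: zero_divisors_def Ann_def)
  show ?thesis
  proof (cases "x1 * y = 0")
    case True
    then show ?thesis using that x y by blast
  next
    case False
    moreover have "x1 * y \<in> Ann b"
      using y by (simp add: Ann_def mult.left_commute[of b])
    moreover have "x2 * (x1 * y) = 0"
      using x by (metis mult.assoc mult.commute mult_zero_left)
    ultimately show ?thesis using that x by blast
  qed
qed

lemma orth_dist_matrix_le_3: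
  fixes A B :: "'a::comm_ring_1^'n::finite^'n"
  assumes A: "A \<in> orth_vertices (**) 0" and B: "B \<in> orth_vertices (**) 0"
    and ann: "\<And>a::'a. a \<in> zero_divisors \<Longrightarrow> \<exists>x\<in>Ann a. \<exists>y\<in>Ann a. x \<noteq> 0 \<and> y \<noteq> 0 \<and> x * y = 0"
  shows "orth_dist (**) 0 A B \<le> 3"
proof -
  have zd: "det A \<in> zero_divisors" "det B \<in> zero_divisors"
    using A B det_zero_divisor by (auto simp: orth_vertices_def two_sided_zd_def)
  obtain x y where xy: "x \<in> Ann (det A)" "y \<in> Ann (det B)" "x \<noteq> 0" "y \<noteq> 0" "x * y = 0"
    using orthogonal_annihilators[OF ann[OF zd(1)] zd(2)] by blast
  obtain M where M: "mat x ** M \<noteq> 0" "A ** (mat x ** M) = 0" "(mat x ** M) ** A = 0"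
    using xy two_sided_annihilator by blast
  obtain N where N: "mat y ** N \<noteq> 0" "B ** (mat y ** N) = 0" "(mat y ** N) ** B = 0"
    using xy two_sided_annihilator by blast
  \<comment> \<open>Scalar matrices are central, so both scalars can be moved to the front.\<close>
  have orth: "(mat u ** P) ** (mat v ** Q) = 0" if "u * v = 0" for u v and P Q :: "'a^'n^'n"
  proof -
    have "(mat u ** P) ** (mat v ** Q) = mat v ** ((mat u ** P) ** Q)"
      by (rule mat_mult_left_commute)
    also have "\<dots> = mat v ** (mat u ** (P ** Q))"
      by (simp only: matrix_mul_assoc)
    also have "\<dots> = mat (v * u) ** (P ** Q)"
      by (rule mat_mult_mat_assoc)
    finally have "(mat u ** P) ** (mat v ** Q) = mat (v * u) ** (P ** Q)" .
    then show ?thesis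
      using that by (simp add: mult.commute)
  qed
  show ?thesis
    using M N xy(5) by (intro orth_dist_le_3[OF A B M(1) N(1)] orth) (auto simp: mult.commute)
qed

theorem theorem5:
  assumes "\<exists>a::'a::comm_ring_1. a \<noteq> 0 \<and> a \<in> zero_divisors"
    and "CARD('n::finite) > 1"
  shows "orth_diam (matrix_matrix_mult :: 'a^'n^'n \<Rightarrow> 'a^'n^'n \<Rightarrow> 'a^'n^'n) 0 \<ge> 3
    \<and> (orth_diam (matrix_matrix_mult :: 'a^'n^'n \<Rightarrow> 'a^'n^'n \<Rightarrow> 'a^'n^'n) 0 > 3
         \<longleftrightarrow> (\<exists>a::'a. a \<in> zero_divisors \<and>
               (\<forall>x \<in> Ann a. \<forall>y \<in> Ann a. x \<noteq> 0 \<and> y \<noteq> 0 \<longrightarrow> x * y \<noteq> 0)))"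
    (is "?diam \<ge> 3 \<and> (?diam > 3 \<longleftrightarrow> ?dom)")
proof (intro conjI iffI)
  obtain i j :: 'n where ij: "i \<noteq> j"
    using assms(2) by (metis (full_types) UNIV_I card_le_Suc0_iff_eq finite linorder_not_le One_nat_def)
  \<comment> \<open>Both lower bounds come from this pair and differ only in the choice of
    \<open>a\<close>.\<close>
  have diam: "orth_dist (**) 0 (swap_mat i j a :: 'a^'n^'n) (swap_mat j i a) \<le> ?diam"
    if "a \<in> zero_divisors" for a
    using that ij by (intro orth_diam_ge swap_mat_vertex) auto
  obtain a :: 'a where "a \<in> zero_divisors"
    using assms(1) by blast
  then show "3 \<le> ?diam"
    using swap_mat_dist_ge_3[OF ij] diam order_trans by blast
  show "3 < ?diam" if ?dom
    using that swap_mat_dist_gt_3[OF ij] diam less_le_trans by blast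
  show ?dom if "3 < ?diam"
  proof (rule ccontr)
    assume "\<not> ?dom"
    then have ann: "\<exists>x\<in>Ann a. \<exists>y\<in>Ann a. x \<noteq> 0 \<and> y \<noteq> 0 \<and> x * y = 0"
      if "a \<in> zero_divisors" for a :: 'a
      using that by meson
    have "orth_dist (**) 0 A B \<le> 3"
      if "A \<in> orth_vertices (**) 0" "B \<in> orth_vertices (**) 0" for A B :: "'a^'n^'n"
      using that ann by (rule orth_dist_matrix_le_3)
    then have "?diam \<le> 3"
      unfolding orth_diam_def by (intro SUP_least)
    with that show False by simp
  qed
qed

end
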